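(* Suppose that the inequality $$y+\sum_{j\in[n]}\alpha_jz_j\geq\beta$$ is facet-defining for $\mathrm{conv}(\mathcal{Q})$ for some $(\alpha,\beta)\in\mathbb{R}^n\times\mathbb{R}$. Then: (i) $(\alpha,\beta)$ is an extreme point of $\mathcal{G}$; (ii) $\beta=h_1+f_0(\alpha)$; and (iii) if $\alpha_k<0$ for some $1\leq k\leq n$, then $a_k>0$.
   Context: Let $n\ge 1$ be an integer and $[n]=\{1,\dots,n\}$. Let $h_1\geq h_2\geq\cdots\geq h_n\geq 0$ be reals, let $a\in\mathbb{R}^n$ with $a_j\ge 0$ for all $j$, and let $p\ge 0$ be real, with $a_j\leq p$ for all $j\in[n]$ and $\sum_{j\in[n]}a_j>p$. Define $$\mathcal{Q}:=\Big\{(y,z)\in\mathbb{R}_+\times\{0,1\}^n:\ \sum_{j\in[n]}a_jz_j\leq p,\ \ y+h_jz_j\geq h_j\ \ \forall j\in[n]\Big\},$$ where $\mathbb{R}_+$ denotes the nonnegative reals ($\mathrm{conv}(\mathcal{Q})$ is full-dimensional in $\mathbb{R}^{n+1}$). Let $\nu:=\max\{k\in\{0,\dots,n\}:\sum_{j\leq k}a_j\leq p\}$ (so $\nu<n$). For $0\leq k\leq\nu$ let $$\mathcal{P}_k:=\Big\{z\in\{0,1\}^n:\ \sum_{j>k}a_jz_j\leq p-\sum_{j\leq k}a_j\Big\}.$$ The coefficient polyhedron $\mathcal{G}$ is the set of all $(\alpha,\beta)\in\mathbb{R}^n\times\mathbb{R}$ such that $$\sum_{j\leq k}\alpha_j+\sum_{j>k}\alpha_jz^*_j+h_{k+1}\geq\beta\qquad\forall\,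 z^*\in\mathcal{P}_k,\ \forall\, 0\leq k\leq\nu.$$ For $\alpha\in\mathbb{R}^n$ and $0\le k\le \nu$, $f_k(\alpha):=\min\{\sum_{j>k}\alpha_jz_j:\ z\in\mathcal{P}_k\}$; in particular $f_0(\alpha)=\min\{\sum_{j\in[n]}\alpha_jz_j:\ z\in\{0,1\}^n,\ \sum_{j\in[n]}a_jz_j\leq p\}$. *)

theory Defs
  imports "HOL-Analysis.Analysis"
begin

text \<open>
  Vectors in \<open>\<real>\<^sup>n\<close> are elements of \<^typ>\<open>real ^ 'n\<close> with \<open>n = CARD('n)\<close>. Prefixes
  \<open>{1, \<dots>, k}\<close> of the index set matter here but \<^typ>\<open>'n\<close> carries no order, so a labelling
  \<open>ix\<close> of the coordinates, always assumed to be a bijection from \<open>{1..CARD('n)}\<close> onto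
  the index type, is passed around: the \<open>j\<close>-th coordinate of \<open>v\<close> is \<open>v $ ix j\<close>.
\<close>

definition binary_vectors :: "(real ^ 'n) set"
  where "binary_vectors = {z. \<forall>i. z $ i \<in> {0, 1}}"

definition mixing_set ::
    "(nat \<Rightarrow> 'n::finite) \<Rightarrow> real ^ 'n \<Rightarrow> real ^ 'n \<Rightarrow> real \<Rightarrow> (real \<times> (real ^ 'n)) set"
  where "mixing_set ix h a p =
    {(y, z). y \<ge> 0 \<and> z \<in> binary_vectors \<and>
       (\<Sum>j = 1..CARD('n). a $ ix j * z $ ix j) \<le> p \<and>
       (\<forall>j \<in> {1..CARD('n)}. y + h $ ix j * z $ ix j \<ge> h $ ix j)}"

text \<open>
  Below, \<open>ix\<close> is a labelling, \<open>a\<close> and \<open>p\<close> are nonnegative and \<open>p\<close> is less than the sum of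
  all coordinates of \<open>a\<close>. Then \<open>nu ix a p < CARD('n)\<close>, so \<open>ix (k+1)\<close> is a genuine label for
  \<open>k \<le> nu ix a p\<close>, and the sets under \<open>Max\<close> and (for such \<open>k\<close>) \<open>Min\<close> are finite and nonempty.
\<close>

definition nu :: "(nat \<Rightarrow> 'n::finite) \<Rightarrow> real ^ 'n \<Rightarrow> real \<Rightarrow> nat"
  where "nu ix a p = Max {k \<in> {0..CARD('n)}. (\<Sum>j = 1..k. a $ ix j) \<le> p}"

definition tail_knapsack ::
    "(nat \<Rightarrow> 'n::finite) \<Rightarrow> real ^ 'n \<Rightarrow> real \<Rightarrow> nat \<Rightarrow> (real ^ 'n) set"
  where "tail_knapsack ix a p k =
    {z \<in> binary_vectors.
       (\<Sum>j = k+1..CARD('n). a $ ix j * z $ ix j) \<le> p - (\<Sum>j = 1..k. a $ ix j)}"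

definition coefficient_polyhedron ::
    "(nat \<Rightarrow> 'n::finite) \<Rightarrow> real ^ 'n \<Rightarrow> real ^ 'n \<Rightarrow> real \<Rightarrow> ((real ^ 'n) \<times> real) set"
  where "coefficient_polyhedron ix h a p =
    {(\<alpha>, \<beta>). \<forall>k \<in> {0..nu ix a p}. \<forall>z \<in> tail_knapsack ix a p k.
       (\<Sum>j = 1..k. \<alpha> $ ix j) + (\<Sum>j = k+1..CARD('n). \<alpha> $ ix j * z $ ix j) + h $ ix (k+1)
         \<ge> \<beta>}"

definition tail_min ::
    "(nat \<Rightarrow> 'n::finite) \<Rightarrow> real ^ 'n \<Rightarrow> real \<Rightarrow> nat \<Rightarrow> real ^ 'n \<Rightarrow> real"
  where "tail_min ix a p k \<alpha> =
    Min ((\<lambda>z. \<Sum>j = k+1..CARD('n). \<alpha> $ ix j * z $ ix j) ` tail_knapsack ix a p k)"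

text \<open>
  The inequality \<open>f x \<ge> b\<close>, for linear \<open>f\<close>, is valid for \<open>S\<close> and the face it induces is a facet.
\<close>

definition facet_defining :: "('a::euclidean_space \<Rightarrow> real) \<Rightarrow> real \<Rightarrow> 'a set \<Rightarrow> bool"
  where "facet_defining f b S \<longleftrightarrow>
    (\<forall>x \<in> S. f x \<ge> b) \<and> {x \<in> S. f x = b} facet_of S"

end

theory Submission
  imports Defs
begin

text \<open>
  Every point of the mixing set has some coordinate \<open>z\<^sub>j = 0\<close>, and the least such \<open>j = k + 1\<close>
  forces \<open>y \<ge> h\<^sub>k\<^sub>+\<^sub>1\<close>. Hence \<open>\<G>\<close> consists precisely of the pairs \<open>(\<alpha>, \<beta>)\<close> for which
  \<open>y + \<alpha> \<bullet> z \<ge> \<beta>\<close> is valid for \<open>\<Q>\<close> (\<open>in_coefficient_polyhedron_iff\<close>).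

  The convex hull of \<open>\<Q>\<close> is full-dimensional, so if the inequality is facet-defining, then the
  points of \<open>\<Q>\<close> at which it is tight affinely span the whole hyperplane \<open>y + \<alpha> \<bullet> z = \<beta>\<close>
  (\<open>affine_hull_tight_points\<close>). This hyperplane is the graph of a function of \<open>z\<close>, so every
  linear equation that holds at all tight points of \<open>\<Q>\<close> holds at \<open>(\<beta> - \<alpha> \<bullet> z, z)\<close> for every
  real vector \<open>z\<close> (\<open>tight_points_equation\<close>). In particular, no coordinate \<open>z\<^sub>k\<close> equals 1 at
  all tight points. The three claims follow.

  \<^item> If \<open>(\<alpha>, \<beta>)\<close> lies strictly between two elements of \<open>\<G>\<close>, then both of them are tight
    wherever \<open>(\<alpha>, \<beta>)\<close> is, so they define the same hyperplane and coincide.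
  \<^item> Validity at \<open>(h\<^sub>1, z)\<close> gives \<open>\<beta> \<le> h\<^sub>1 + f\<^sub>0(\<alpha>)\<close>. If the inequality were strict, every
    tight point would have \<open>y < h\<^sub>1\<close> and hence \<open>z\<^sub>1 = 1\<close>.
  \<^item> If \<open>\<alpha>\<^sub>k < 0\<close> and \<open>a\<^sub>k = 0\<close>, then raising \<open>z\<^sub>k\<close> from 0 to 1 keeps feasibility and decreases
    the left-hand side, so every tight point would have \<open>z\<^sub>k = 1\<close>.
\<close>

section \<open>Facet-defining inequalities of full-dimensional convex hulls\<close>

text \<open>
  A convex combination with positive weights attains the bound only if every point in it does.
\<close>

lemma tight_points_convex_hull:
  fixes S :: "'a::real_inner set"
  assumes valid: "\<And>x. x \<in> S \<Longrightarrow> b \<le> c \<bullet> x"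
  shows "{x \<in> convex hull S. c \<bullet> x = b} \<subseteq> convex hull {x \<in> S. c \<bullet> x = b}"
proof -
  let ?H = "convex hull {x \<in> S. c \<bullet> x = b}"
  define X where "X = {x. b \<le> c \<bullet> x \<and> (c \<bullet> x = b \<longrightarrow> x \<in> ?H)}"
  have "convex X"
  proof (rule convexI)
    fix x y and u v :: real
    assume x: "x \<in> X" and y: "y \<in> X" and uv: "0 \<le> u" "0 \<le> v" "u + v = 1"
    show "u *\<^sub>R x + v *\<^sub>R y \<in> X"
    proof (cases "u = 0 \<or> v = 0")
      case True
      then show ?thesis using x y uv by auto
    next
      case False
      then have pos: "0 < u" "0 < v" using uv by auto
      have slack: "c \<bullet> (u *\<^sub>R x + v *\<^sub>R y) - b = u * (c \<bullet> x - b) + v * (c \<bullet> y - b)"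
        using uv(3) by (simp add: inner_add_right algebra_simps flip: distrib_left)
      have nonneg: "0 \<le> u * (c \<bullet> x - b)" "0 \<le> v * (c \<bullet> y - b)"
        using x y pos by (auto simp: X_def)
      have "u *\<^sub>R x + v *\<^sub>R y \<in> ?H" if "c \<bullet> (u *\<^sub>R x + v *\<^sub>R y) = b"
      proof -
        have "u * (c \<bullet> x - b) = 0" "v * (c \<bullet> y - b) = 0"
          using slack nonneg that by linarith+
        then have "x \<in> ?H" "y \<in> ?H"
          using x y pos by (auto simp: X_def)
        then show ?thesis
          using convexD[OF convex_convex_hull] uv by blast
      qed
      then show ?thesis
        using slack nonneg by (auto simp: X_def)
    qed
  qed
  moreover have "S \<subseteq> X"
    using valid by (auto simp: X_def intro: hull_inc)
  ultimately have "convex hull S \<subseteq> X"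
    by (rule hull_minimal[rotated])
  then show ?thesis
    by (auto simp: X_def)
qed

text \<open>A facet of a full-dimensional set has the dimension of the hyperplane that supports it.\<close>

lemma affine_hull_tight_points:
  fixes S :: "'a::euclidean_space set"
  assumes facet: "facet_defining (\<lambda>x. c \<bullet> x) b (convex hull S)"
    and full_dim: "aff_dim S = DIM('a)"
    and "c \<noteq> 0"
  shows "affine hull {x \<in> S. c \<bullet> x = b} = {x. c \<bullet> x = b}"
proof (rule antisym)
  show "affine hull {x \<in> S. c \<bullet> x = b} \<subseteq> {x. c \<bullet> x = b}"
    by (rule hull_minimal) (auto simp: affine_hyperplane)
next
  let ?F = "{x \<in> convex hull S. c \<bullet> x = b}"
  have valid: "b \<le> c \<bullet> x" if "x \<in> S" for x
    using facet that by (auto simp: facet_defining_def intro: hull_inc)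
  have F: "?F \<noteq> {}" "aff_dim ?F = int DIM('a) - 1"
    using facet full_dim by (auto simp: facet_defining_def facet_of_def aff_dim_convex_hull)
  have "affine hull ?F = {x. c \<bullet> x = b}"
  proof (rule affine_dim_equal)
    show "affine hull ?F \<subseteq> {x. c \<bullet> x = b}"
      by (rule hull_minimal) (auto simp: affine_hyperplane)
    show "aff_dim (affine hull ?F) = aff_dim {x. c \<bullet> x = b}"
      using F(2) \<open>c \<noteq> 0\<close> by simp
    show "affine hull ?F \<noteq> {}"
      using F(1) affine_hull_eq_empty by blast
  qed (simp_all add: affine_hyperplane)
  moreover have "affine hull ?F \<subseteq> affine hull {x \<in> S. c \<bullet> x = b}"
    using hull_mono[OF tight_points_convex_hull[OF valid], of S affine]
    by (simp add: affine_hull_convex_hull)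
  ultimately show "{x. c \<bullet> x = b} \<subseteq> affine hull {x \<in> S. c \<bullet> x = b}"
    by blast
qed

section \<open>The mixing set with a knapsack constraint\<close>

lemma finite_binary_vectors: "finite (binary_vectors :: (real ^ 'n::finite) set)"
proof (rule finite_subset)
  show "binary_vectors \<subseteq> range (\<lambda>A :: 'n set. \<chi> i. if i \<in> A then 1 else (0 :: real))"
  proof
    fix z :: "real ^ 'n"
    assume "z \<in> binary_vectors"
    then have "z $ i = (if i \<in> {i. z $ i = 1} then 1 else 0)" for i
      by (auto simp: binary_vectors_def)
    then have "z = (\<chi> i. if i \<in> {i. z $ i = 1} then 1 else 0)"
      by (simp add: vec_eq_iff)
    then show "z \<in> range (\<lambda>A. \<chi> i. if i \<in> A then 1 else 0)"
      by (rule range_eqI)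
  qed
qed simp

text \<open>The standing assumptions on the data defining \<open>\<Q>\<close>.\<close>

locale knapsack_mixing =
  fixes ix :: "nat \<Rightarrow> 'n::finite"
    and h a :: "real ^ 'n"
    and p :: real
  assumes ix: "bij_betw ix {1..CARD('n)} UNIV"
    and h_decreasing: "\<And>i j. 1 \<le> i \<Longrightarrow> i \<le> j \<Longrightarrow> j \<le> CARD('n) \<Longrightarrow> h $ ix j \<le> h $ ix i"
    and h_nonneg: "\<And>j. j \<in> {1..CARD('n)} \<Longrightarrow> h $ ix j \<ge> 0"
    and a_nonneg: "\<And>j. j \<in> {1..CARD('n)} \<Longrightarrow> a $ ix j \<ge> 0"
    and p_nonneg: "p \<ge> 0"
    and a_le_p: "\<And>j. j \<in> {1..CARD('n)} \<Longrightarrow> a $ ix j \<le> p"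
    and sum_a: "(\<Sum>j = 1..CARD('n). a $ ix j) > p"
begin

lemma sum_eq_inner: "(\<Sum>j = 1..CARD('n). v $ ix j * w $ ix j) = v \<bullet> w"
  using sum.reindex_bij_betw[OF ix, of "\<lambda>i. v $ i * w $ i"] by (simp add: inner_vec_def)

lemma ex_label: "\<exists>j \<in> {1..CARD('n)}. i = ix j"
  using ix by (auto simp: bij_betw_def)

lemma card_pos: "1 \<le> CARD('n)"
  by (simp add: Suc_leI)

lemma mem_mixing_set:
  "(y, z) \<in> mixing_set ix h a p \<longleftrightarrow>
     y \<ge> 0 \<and> z \<in> binary_vectors \<and> a \<bullet> z \<le> p \<and>
     (\<forall>j \<in> {1..CARD('n)}. y + h $ ix j * z $ ix j \<ge> h $ ix j)"
  unfolding mixing_set_def sum_eq_inner by simp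

lemma mixing_setI_large:
  assumes "h $ ix 1 \<le> y" "z \<in> binary_vectors" "a \<bullet> z \<le> p"
  shows "(y, z) \<in> mixing_set ix h a p"
proof -
  have "h $ ix j \<le> y + h $ ix j * z $ ix j" if j: "j \<in> {1..CARD('n)}" for j
  proof -
    have "h $ ix j \<le> y"
      using h_decreasing[of 1 j] j assms(1) by auto
    moreover have "0 \<le> h $ ix j * z $ ix j"
    proof (rule mult_nonneg_nonneg[OF h_nonneg[OF j]])
      have "z $ ix j \<in> {0, 1}"
        using assms(2) by (simp add: binary_vectors_def)
      then show "0 \<le> z $ ix j" by auto
    qed
    ultimately show ?thesis by linarith
  qed
  moreover have "0 \<le> y"
    using h_nonneg[of 1] card_pos assms(1) by simp
  ultimately show ?thesis
    using assms by (auto simp: mem_mixing_set)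
qed

text \<open>
  No hyperplane contains both the points \<open>(y, 0)\<close> for \<open>y \<ge> h\<^sub>1\<close> and the points \<open>(h\<^sub>1, e\<^sub>i)\<close>; the
  latter are feasible because \<open>a\<^sub>i \<le> p\<close>.
\<close>

lemma aff_dim_mixing_set: "aff_dim (mixing_set ix h a p) = DIM(real \<times> (real ^ 'n))"
proof (rule ccontr)
  let ?Q = "mixing_set ix h a p"
  assume "aff_dim ?Q \<noteq> DIM(real \<times> (real ^ 'n))"
  then have "aff_dim ?Q < DIM(real \<times> (real ^ 'n))"
    using aff_dim_le_DIM[of ?Q] by linarith
  then obtain c b where c: "c \<noteq> 0" and sub: "?Q \<subseteq> {x. c \<bullet> x = b}"
    by (rule aff_lowdim_subset_hyperplane)
  obtain g d where gd: "c = (g, d)" by force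
  have zero: "(y, 0) \<in> ?Q" if "h $ ix 1 \<le> y" for y
    using that p_nonneg by (intro mixing_setI_large) (auto simp: binary_vectors_def)
  have unit: "(h $ ix 1, axis i 1) \<in> ?Q" for i
  proof (rule mixing_setI_large)
    obtain j where "j \<in> {1..CARD('n)}" "i = ix j"
      using ex_label by blast
    then show "a \<bullet> axis i 1 \<le> p"
      using a_le_p by (simp add: inner_axis)
  qed (auto simp: binary_vectors_def axis_def)
  have "g * h $ ix 1 = b" "g * (h $ ix 1 + 1) = b"
    using sub zero[of "h $ ix 1"] zero[of "h $ ix 1 + 1"] by (auto simp: gd)
  then have g: "g = 0" and b: "b = 0"
    by (auto simp: algebra_simps)
  have "d $ i = 0" for i
    using sub unit[of i] by (auto simp: gd g b inner_axis)
  then have "d = 0"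
    by (simp add: vec_eq_iff)
  then show False
    using c g gd by (simp add: zero_prod_def)
qed

lemma nu_props:
  shows nu_less: "nu ix a p < CARD('n)"
    and le_nu_iff: "k \<le> CARD('n) \<Longrightarrow> k \<le> nu ix a p \<longleftrightarrow> (\<Sum>j = 1..k. a $ ix j) \<le> p"
proof -
  let ?K = "{k \<in> {0..CARD('n)}. (\<Sum>j = 1..k. a $ ix j) \<le> p}"
  have fin: "finite ?K" and ne: "0 \<in> ?K"
    using p_nonneg by auto
  have nu: "nu ix a p \<in> ?K"
    unfolding nu_def using Max_in[OF fin] ne by blast
  then show "nu ix a p < CARD('n)"
    using sum_a by (cases "nu ix a p = CARD('n)") auto
  assume k: "k \<le> CARD('n)"
  show "k \<le> nu ix a p \<longleftrightarrow> (\<Sum>j = 1..k. a $ ix j) \<le> p"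
  proof
    assume "k \<le> nu ix a p"
    then have "(\<Sum>j = 1..k. a $ ix j) \<le> (\<Sum>j = 1..nu ix a p. a $ ix j)"
      using nu by (intro sum_mono2) (auto intro!: a_nonneg)
    then show "(\<Sum>j = 1..k. a $ ix j) \<le> p"
      using nu by auto
  next
    assume "(\<Sum>j = 1..k. a $ ix j) \<le> p"
    then have "k \<in> ?K" using k by simp
    then show "k \<le> nu ix a p"
      unfolding nu_def using fin by (rule Max_ge[rotated])
  qed
qed

text \<open>
  With \<open>w = z\<close>, this splits \<open>v \<bullet> z\<close> after a prefix of ones of \<open>z\<close>; in general, \<open>z\<close> arises from
  \<open>w\<close> by overwriting the first \<open>k\<close> coordinates with ones.
\<close>

lemma inner_eq_prefix_tail:
  assumes "k \<le> CARD('n)" and ones: "\<And>j. j \<in> {1..k} \<Longrightarrow> z $ ix j = 1"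
    and tail: "\<And>j. j \<in> {k+1..CARD('n)} \<Longrightarrow> z $ ix j = w $ ix j"
  shows "v \<bullet> z = (\<Sum>j = 1..k. v $ ix j) + (\<Sum>j = k+1..CARD('n). v $ ix j * w $ ix j)"
proof -
  have "v \<bullet> z = (\<Sum>j = 1..k. v $ ix j * z $ ix j) + (\<Sum>j = k+1..CARD('n). v $ ix j * z $ ix j)"
    using sum.ub_add_nat[of 1 k "\<lambda>j. v $ ix j * z $ ix j" "CARD('n) - k"] assms(1)
    by (simp add: sum_eq_inner[of v z, symmetric])
  also have "\<dots> = (\<Sum>j = 1..k. v $ ix j) + (\<Sum>j = k+1..CARD('n). v $ ix j * w $ ix j)"
    using ones tail by (intro arg_cong2[of _ _ _ _ "(+)"] sum.cong) auto
  finally show ?thesis .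
qed

text \<open>The polyhedron \<open>\<G>\<close> collects all valid inequalities in which \<open>y\<close> has coefficient 1.\<close>

lemma in_coefficient_polyhedron_iff:
  "(\<alpha>, \<beta>) \<in> coefficient_polyhedron ix h a p \<longleftrightarrow>
     (\<forall>(y, z) \<in> mixing_set ix h a p. \<beta> \<le> y + \<alpha> \<bullet> z)"
proof
  assume G: "(\<alpha>, \<beta>) \<in> coefficient_polyhedron ix h a p"
  have "\<beta> \<le> y + \<alpha> \<bullet> z" if Q: "(y, z) \<in> mixing_set ix h a p" for y z
  proof -
    have bin: "z $ i \<in> {0, 1}" for i
      using Q by (auto simp: mem_mixing_set binary_vectors_def)
    have az: "a \<bullet> z \<le> p"
      using Q by (simp add: mem_mixing_set)
    \<comment> \<open>The longest prefix of ones of \<open>z\<close> decides which constraint of \<open>\<G>\<close> to use.\<close>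
    define m where "m = (LEAST j. j \<in> {1..CARD('n)} \<and> z $ ix j = 0)"
    have "\<exists>j. j \<in> {1..CARD('n)} \<and> z $ ix j = 0"
    proof (rule ccontr)
      assume "\<not> ?thesis"
      then have "z $ ix j = 1" if "j \<in> {1..CARD('n)}" for j
        using bin that by blast
      then have "(\<Sum>j = 1..CARD('n). a $ ix j * z $ ix j) = (\<Sum>j = 1..CARD('n). a $ ix j)"
        by (intro sum.cong) auto
      then show False
        using az sum_a sum_eq_inner[of a z] by linarith
    qed
    from LeastI_ex[OF this] have m: "m \<in> {1..CARD('n)} \<and> z $ ix m = 0"
      by (simp only: m_def)
    define k where "k = m - 1"
    have k: "m = k + 1" "k < CARD('n)"
      using m by (auto simp: k_def)
    have ones: "z $ ix j = 1" if "j \<in> {1..k}" for j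
    proof -
      have "j < m"
        using that k by simp
      then have "\<not> (j \<in> {1..CARD('n)} \<and> z $ ix j = 0)"
        unfolding m_def by (rule not_less_Least)
      then show ?thesis
        using that k bin[of "ix j"] by auto
    qed
    note split = inner_eq_prefix_tail[OF less_imp_le[OF k(2)] ones refl]
    have knap: "(\<Sum>j = 1..k. a $ ix j) + (\<Sum>j = k+1..CARD('n). a $ ix j * z $ ix j) \<le> p"
      using az split[of a] by simp
    moreover have "0 \<le> (\<Sum>j = k+1..CARD('n). a $ ix j * z $ ix j)"
    proof (intro sum_nonneg mult_nonneg_nonneg)
      fix j assume "j \<in> {k+1..CARD('n)}"
      then show "0 \<le> a $ ix j" by (intro a_nonneg) auto
      show "0 \<le> z $ ix j" using bin[of "ix j"] by auto
    qed
    ultimately have "k \<le> nu ix a p"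
      using le_nu_iff[of k] k by auto
    moreover have "z \<in> tail_knapsack ix a p k"
      using knap bin by (auto simp: tail_knapsack_def binary_vectors_def)
    ultimately have "\<beta> \<le> (\<Sum>j = 1..k. \<alpha> $ ix j)
        + (\<Sum>j = k+1..CARD('n). \<alpha> $ ix j * z $ ix j) + h $ ix (k+1)"
      using G by (auto simp: coefficient_polyhedron_def)
    also have "\<dots> = \<alpha> \<bullet> z + h $ ix (k+1)"
      using split[of \<alpha>] by simp
    also have "h $ ix (k+1) \<le> y"
    proof -
      have "h $ ix m \<le> y + h $ ix m * z $ ix m"
        using Q m unfolding mem_mixing_set by blast
      then show ?thesis
        using m k(1) by simp
    qed
    finally show ?thesis by simp
  qed
  then show "\<forall>(y, z) \<in> mixing_set ix h a p. \<beta> \<le> y + \<alpha> \<bullet> z"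
    by auto
next
  assume valid: "\<forall>(y, z) \<in> mixing_set ix h a p. \<beta> \<le> y + \<alpha> \<bullet> z"
  have "\<beta> \<le> (\<Sum>j = 1..k. \<alpha> $ ix j)
      + (\<Sum>j = k+1..CARD('n). \<alpha> $ ix j * w $ ix j) + h $ ix (k+1)"
    if "k \<in> {0..nu ix a p}" and w: "w \<in> tail_knapsack ix a p k" for k w
  proof -
    have k: "k < CARD('n)"
      using that(1) nu_less by simp
    have bin_w: "w $ i \<in> {0, 1}" for i
      using w by (auto simp: tail_knapsack_def binary_vectors_def)
    \<comment> \<open>The constraint for \<open>(k, w)\<close> is the inequality at the feasible point \<open>(h\<^sub>k\<^sub>+\<^sub>1, z)\<close>.\<close>
    define z where "z = (\<chi> i. if i \<in> ix ` {1..k} then 1 else w $ i)"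
    have ones: "z $ ix j = 1" if "j \<in> {1..k}" for j
      using that by (auto simp: z_def)
    have "ix j \<notin> ix ` {1..k}" if "j \<in> {k+1..CARD('n)}" for j
    proof
      assume "ix j \<in> ix ` {1..k}"
      then obtain l where "l \<in> {1..k}" "ix l = ix j" by auto
      then have "l = j"
        using inj_onD[OF bij_betw_imp_inj_on[OF ix], of l j] that k by simp
      then show False using \<open>l \<in> {1..k}\<close> that by auto
    qed
    then have tail: "z $ ix j = w $ ix j" if "j \<in> {k+1..CARD('n)}" for j
      using that by (simp add: z_def)
    note split = inner_eq_prefix_tail[OF less_imp_le[OF k] ones tail]
    have bin: "z $ i \<in> {0, 1}" for i
      using bin_w[of i] by (auto simp: z_def)
    have "a \<bullet> z \<le> p"
      using w split[of a] by (simp add: tail_knapsack_def)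
    moreover have "0 \<le> h $ ix (k+1)"
      using k by (intro h_nonneg) auto
    moreover have "h $ ix j \<le> h $ ix (k+1) + h $ ix j * z $ ix j" if j: "j \<in> {1..CARD('n)}" for j
    proof (cases "j \<le> k")
      case True
      then show ?thesis using ones[of j] j \<open>0 \<le> h $ ix (k+1)\<close> by auto
    next
      case False
      then have "h $ ix j \<le> h $ ix (k+1)"
        using h_decreasing[of "k+1" j] j by auto
      moreover have "0 \<le> h $ ix j * z $ ix j"
        using h_nonneg[OF j] bin[of "ix j"] by auto
      ultimately show ?thesis by linarith
    qed
    ultimately have "(h $ ix (k+1), z) \<in> mixing_set ix h a p"
      using bin by (auto simp: mem_mixing_set binary_vectors_def)
    then have "\<beta> \<le> h $ ix (k+1) + \<alpha> \<bullet> z"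
      using valid by auto
    then show ?thesis
      using split[of \<alpha>] by simp
  qed
  then show "(\<alpha>, \<beta>) \<in> coefficient_polyhedron ix h a p"
    unfolding coefficient_polyhedron_def mem_Collect_eq prod.case by blast
qed

lemma tail_min_0:
  shows tail_min_0_le: "z \<in> binary_vectors \<Longrightarrow> a \<bullet> z \<le> p \<Longrightarrow> tail_min ix a p 0 \<alpha> \<le> \<alpha> \<bullet> z"
    and tail_min_0_attained:
      "\<exists>z \<in> binary_vectors. a \<bullet> z \<le> p \<and> tail_min ix a p 0 \<alpha> = \<alpha> \<bullet> z"
proof -
  let ?K = "{z \<in> binary_vectors. a \<bullet> z \<le> p}"
  have eq: "tail_min ix a p 0 \<alpha> = Min ((\<lambda>z. \<alpha> \<bullet> z) ` ?K)"
    by (simp add: tail_min_def tail_knapsack_def sum_eq_inner[simplified])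
  have fin: "finite ((\<lambda>z. \<alpha> \<bullet> z) ` ?K)"
    by (intro finite_imageI finite_subset[OF _ finite_binary_vectors]) auto
  have "0 \<in> ?K"
    using p_nonneg by (simp add: binary_vectors_def)
  then have "Min ((\<lambda>z. \<alpha> \<bullet> z) ` ?K) \<in> (\<lambda>z. \<alpha> \<bullet> z) ` ?K"
    by (intro Min_in[OF fin]) blast
  then show "\<exists>z \<in> binary_vectors. a \<bullet> z \<le> p \<and> tail_min ix a p 0 \<alpha> = \<alpha> \<bullet> z"
    unfolding eq by auto
  show "tail_min ix a p 0 \<alpha> \<le> \<alpha> \<bullet> z" if "z \<in> binary_vectors" "a \<bullet> z \<le> p"
    unfolding eq using that by (intro Min_le[OF fin]) auto
qed

end

section \<open>Facet-defining inequalities of the mixing set\<close>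

text \<open>In addition, \<open>y + \<alpha> \<bullet> z \<ge> \<beta>\<close> is facet-defining for the convex hull of \<open>\<Q>\<close>.\<close>

locale mixing_facet = knapsack_mixing ix h a p
  for ix :: "nat \<Rightarrow> 'n::finite" and h a :: "real ^ 'n" and p :: real +
  fixes \<alpha> :: "real ^ 'n" and \<beta> :: real
  assumes facet: "facet_defining (\<lambda>(y, z). y + (\<Sum>j = 1..CARD('n). \<alpha> $ ix j * z $ ix j)) \<beta>
                    (convex hull (mixing_set ix h a p))"
begin

lemma facet_inner: "facet_defining (\<lambda>x. (1, \<alpha>) \<bullet> x) \<beta> (convex hull (mixing_set ix h a p))"
proof -
  have "(\<lambda>(y, z). y + (\<Sum>j = 1..CARD('n). \<alpha> $ ix j * z $ ix j)) = (\<lambda>x. (1, \<alpha>) \<bullet> x)"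
    unfolding sum_eq_inner by auto
  then show ?thesis
    using facet by simp
qed

lemma valid: "(y, z) \<in> mixing_set ix h a p \<Longrightarrow> \<beta> \<le> y + \<alpha> \<bullet> z"
  using facet_inner hull_inc[of "(y, z)" "mixing_set ix h a p" convex]
  by (auto simp: facet_defining_def)

text \<open>
  A hyperplane containing all tight points of \<open>\<Q>\<close> contains the hyperplane \<open>y + \<alpha> \<bullet> z = \<beta>\<close>, and
  here the latter is parametrized by \<open>z\<close>.
\<close>

lemma tight_points_equation:
  assumes "\<And>y z. (y, z) \<in> mixing_set ix h a p \<Longrightarrow> y + \<alpha> \<bullet> z = \<beta> \<Longrightarrow> g * y + d \<bullet> z = e"
  shows "g * (\<beta> - \<alpha> \<bullet> z) + d \<bullet> z = e"
proof -
  let ?T = "{x \<in> mixing_set ix h a p. (1, \<alpha>) \<bullet> x = \<beta>}"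
  have "affine hull ?T = {x. (1, \<alpha>) \<bullet> x = \<beta>}"
    by (rule affine_hull_tight_points[OF facet_inner aff_dim_mixing_set]) (simp add: zero_prod_def)
  moreover have "affine hull ?T \<subseteq> {x. (g, d) \<bullet> x = e}"
    using assms by (intro hull_minimal) (auto simp: affine_hyperplane)
  moreover have "(\<beta> - \<alpha> \<bullet> z, z) \<in> {x. (1, \<alpha>) \<bullet> x = \<beta>}"
    by simp
  ultimately have "(\<beta> - \<alpha> \<bullet> z, z) \<in> {x. (g, d) \<bullet> x = e}"
    by blast
  then show ?thesis
    by simp
qed

lemma ex_tight_coordinate_zero:
  "\<exists>y z. (y, z) \<in> mixing_set ix h a p \<and> y + \<alpha> \<bullet> z = \<beta> \<and> z $ i = 0"
proof (rule ccontr)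
  assume none: "\<not> ?thesis"
  have "0 * y + axis i 1 \<bullet> z = 1" if "(y, z) \<in> mixing_set ix h a p" "y + \<alpha> \<bullet> z = \<beta>" for y z
  proof -
    have "z $ i \<in> {0, 1}"
      using that(1) by (auto simp: mem_mixing_set binary_vectors_def)
    then show ?thesis
      using none that by (auto simp: inner_axis')
  qed
  from tight_points_equation[OF this, of 0] show False
    by simp
qed

lemma eq_if_tight_everywhere:
  assumes "\<And>y z. (y, z) \<in> mixing_set ix h a p \<Longrightarrow> y + \<alpha> \<bullet> z = \<beta> \<Longrightarrow> y + \<alpha>' \<bullet> z = \<beta>'"
  shows "(\<alpha>', \<beta>') = (\<alpha>, \<beta>)"
proof -
  have eq: "\<beta> - \<alpha> \<bullet> z + \<alpha>' \<bullet> z = \<beta>'" for z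
    using tight_points_equation[of 1 \<alpha>' \<beta>' z] assms by simp
  have "\<beta>' = \<beta>"
    using eq[of 0] by simp
  moreover have "\<alpha>' = \<alpha>"
    using eq[of "axis i 1" for i] \<open>\<beta>' = \<beta>\<close> by (simp add: vec_eq_iff inner_axis)
  ultimately show ?thesis by simp
qed

theorem extreme_point: "(\<alpha>, \<beta>) extreme_point_of coefficient_polyhedron ix h a p"
  unfolding extreme_point_of_def
proof (intro conjI ballI notI)
  show "(\<alpha>, \<beta>) \<in> coefficient_polyhedron ix h a p"
    using valid by (auto simp: in_coefficient_polyhedron_iff)
next
  fix s t
  assume G: "s \<in> coefficient_polyhedron ix h a p" "t \<in> coefficient_polyhedron ix h a p"
    and "(\<alpha>, \<beta>) \<in> open_segment s t"
  obtain \<alpha>1 \<beta>1 \<alpha>2 \<beta>2 where st: "s = (\<alpha>1, \<beta>1)" "t = (\<alpha>2, \<beta>2)"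
    by fastforce
  obtain u where u: "0 < u" "u < 1" "(\<alpha>, \<beta>) = (1 - u) *\<^sub>R s + u *\<^sub>R t" and "s \<noteq> t"
    using \<open>(\<alpha>, \<beta>) \<in> open_segment s t\<close> by (auto simp: in_segment)
  have comb: "\<alpha> = (1 - u) *\<^sub>R \<alpha>1 + u *\<^sub>R \<alpha>2" "\<beta> = (1 - u) * \<beta>1 + u * \<beta>2"
    using u(3) by (auto simp: st)
  have both: "y + \<alpha>1 \<bullet> z = \<beta>1 \<and> y + \<alpha>2 \<bullet> z = \<beta>2"
    if Q: "(y, z) \<in> mixing_set ix h a p" and tight: "y + \<alpha> \<bullet> z = \<beta>" for y z
  proof -
    have "0 \<le> (1 - u) * (y + \<alpha>1 \<bullet> z - \<beta>1)" "0 \<le> u * (y + \<alpha>2 \<bullet> z - \<beta>2)"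
      using G Q u by (auto simp: st in_coefficient_polyhedron_iff)
    moreover have "(1 - u) * (y + \<alpha>1 \<bullet> z - \<beta>1) + u * (y + \<alpha>2 \<bullet> z - \<beta>2) = 0"
      using tight by (simp add: comb inner_add_left algebra_simps)
    ultimately have "(1 - u) * (y + \<alpha>1 \<bullet> z - \<beta>1) = 0" "u * (y + \<alpha>2 \<bullet> z - \<beta>2) = 0"
      by linarith+
    then show ?thesis
      using u by auto
  qed
  have "(\<alpha>1, \<beta>1) = (\<alpha>, \<beta>)" "(\<alpha>2, \<beta>2) = (\<alpha>, \<beta>)"
    by (rule eq_if_tight_everywhere, simp only: both)+
  then show False
    using \<open>s \<noteq> t\<close> st by simp
qed

theorem rhs_eq: "\<beta> = h $ ix 1 + tail_min ix a p 0 \<alpha>"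
proof (rule antisym)
  obtain z where "z \<in> binary_vectors" "a \<bullet> z \<le> p" "tail_min ix a p 0 \<alpha> = \<alpha> \<bullet> z"
    using tail_min_0_attained by blast
  then show "\<beta> \<le> h $ ix 1 + tail_min ix a p 0 \<alpha>"
    using valid[OF mixing_setI_large[of "h $ ix 1" z]] by simp
next
  obtain y z where Q: "(y, z) \<in> mixing_set ix h a p" and tight: "y + \<alpha> \<bullet> z = \<beta>"
    and zero: "z $ ix 1 = 0"
    using ex_tight_coordinate_zero by blast
  have "h $ ix 1 + h $ ix 1 * 0 \<le> y + h $ ix 1 * z $ ix 1"
    using Q card_pos by (auto simp: mem_mixing_set)
  then have "h $ ix 1 \<le> y"
    using zero by simp
  moreover have "tail_min ix a p 0 \<alpha> \<le> \<alpha> \<bullet> z"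
    using Q by (intro tail_min_0_le) (auto simp: mem_mixing_set)
  ultimately show "h $ ix 1 + tail_min ix a p 0 \<alpha> \<le> \<beta>"
    using tight by linarith
qed

theorem weight_pos_if_coefficient_neg:
  assumes k: "k \<in> {1..CARD('n)}" and neg: "\<alpha> $ ix k < 0"
  shows "a $ ix k > 0"
proof (rule ccontr)
  assume "\<not> a $ ix k > 0"
  then have a0: "a $ ix k = 0"
    using a_nonneg[OF k] by simp
  obtain y z where Q: "(y, z) \<in> mixing_set ix h a p" and tight: "y + \<alpha> \<bullet> z = \<beta>"
    and zero: "z $ ix k = 0"
    using ex_tight_coordinate_zero by blast
  define z' where "z' = z + axis (ix k) 1"
  have z': "z' $ i = (if i = ix k then 1 else z $ i)" for i
    using zero by (simp add: z'_def axis_def)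
  have "h $ ix j \<le> y + h $ ix j * z' $ ix j" if "j \<in> {1..CARD('n)}" for j
    using Q that by (auto simp: mem_mixing_set z')
  moreover have "a \<bullet> z' = a \<bullet> z"
    by (simp add: z'_def inner_add_right inner_axis a0)
  ultimately have "(y, z') \<in> mixing_set ix h a p"
    using Q by (auto simp: mem_mixing_set binary_vectors_def z')
  then have "\<beta> \<le> y + \<alpha> \<bullet> z'"
    by (rule valid)
  then show False
    using tight neg by (simp add: z'_def inner_add_right inner_axis)
qed

end

theorem theorem4:
  fixes ix :: "nat \<Rightarrow> 'n::finite"
    and h a \<alpha> :: "real ^ 'n"
    and p \<beta> :: real
  assumes ix: "bij_betw ix {1..CARD('n)} UNIV"
    and h_decreasing: "\<And>i j. 1 \<le> i \<Longrightarrow> i \<le> j \<Longrightarrow> j \<le> CARD('n) \<Longrightarrow> h $ ix j \<le> h $ ix i"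
    and h_nonneg: "\<And>j. j \<in> {1..CARD('n)} \<Longrightarrow> h $ ix j \<ge> 0"
    and a_nonneg: "\<And>j. j \<in> {1..CARD('n)} \<Longrightarrow> a $ ix j \<ge> 0"
    and p_nonneg: "p \<ge> 0"
    and a_le_p: "\<And>j. j \<in> {1..CARD('n)} \<Longrightarrow> a $ ix j \<le> p"
    and sum_a: "(\<Sum>j = 1..CARD('n). a $ ix j) > p"
    and facet: "facet_defining (\<lambda>(y, z). y + (\<Sum>j = 1..CARD('n). \<alpha> $ ix j * z $ ix j)) \<beta>
                  (convex hull (mixing_set ix h a p))"
  shows "(\<alpha>, \<beta>) extreme_point_of coefficient_polyhedron ix h a p \<and>
         \<beta> = h $ ix 1 + tail_min ix a p 0 \<alpha> \<and>
         (\<forall>k \<in> {1..CARD('n)}. \<alpha> $ ix k < 0 \<longrightarrow> a $ ix k > 0)"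
proof -
  interpret mixing_facet ix h a p \<alpha> \<beta>
    by unfold_locales (fact assms)+
  show ?thesis
    using extreme_point rhs_eq weight_pos_if_coefficient_neg by blast
qed

end
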